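(* Let $p,q,r$ be non-zero integers such that $|p|\geq q\geq 1$, $r\geq 2$, and $p$ and $q$ are relatively prime. Let $D$ be the standard diagram of the torus link $T(pr,qr)$, i.e. the closure of the braid diagram $B(pr,qr)$, and let $A\subset(\mathbb{Z}^r)^q$ be the set of all $(\boldsymbol{a}_1,\dots,\boldsymbol{a}_q)\in(\mathbb{Z}^r)^q$ such that the assignment of the colors $\boldsymbol{a}_1,\dots,\boldsymbol{a}_q$ to the families $\boldsymbol{x}_1,\dots,\boldsymbol{x}_q$ of left-end arcs of $B(pr,qr)$ defines a $\mathbb{Z}$-coloring of $D$. Then \[ A=\begin{cases} \{(\boldsymbol{a},\dots,\boldsymbol{a})\mid \boldsymbol{a}\in\mathbb{Z}^r,\ \Delta(\boldsymbol{a})=0\} & \text{if } r \text{ is even},\\ \{(\boldsymbol{a},\dots,\boldsymbol{a})\mid \boldsymbol{a}\in\mathbb{Z}^r\} & \text{if } r \text{ is odd and } p \text{ is even},\\ \{(\boldsymbol{a},\tau(\boldsymbol{a}),\boldsymbol{a},\dots,\tau(\boldsymbol{a}))\mid \boldsymbol{a}\in\mathbb{Z}^r\} & \text{if } r \text{ is odd and } q \text{ is even}, \end{cases} \] where, for $\boldsymbol{a}=(a_1,\dots,a_r)\in\mathbb{Z}^r$, $\Delta(\boldsymbol{a})=a_1-a_2+\cdots+(-1)^{r+1}a_r\in\mathbb{Z}$ and $\tau(\boldsymbol{a})=(-a_i+2\Delta(\boldsymbol{a}))_{1\leq i\leq r}\in\mathbb{Z}^r$.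
   Context: A $\mathbb{Z}$-coloring of a link diagram (or braid diagram) is a map $\gamma:\{\text{arcs}\}\to\mathbb{Z}$ such that $2\gamma(a)=\gamma(b)+\gamma(c)$ at each crossing with over arc $a$ and under arcs $b$ and $c$ (trivial, i.e. constant, colorings are allowed). The torus link $T(a,b)$ is the link on the standardly embedded torus in 3-space running $a$ times meridionally and $b$ times longitudinally. For $a,b\geq 1$, let $B(a,b)$ be the braid diagram on $b$ horizontal strands (positions numbered $1,\dots,b$ from top to bottom) obtained by concatenating, from left to right, $a$ copies of the elementary braid diagram in which the strand in position $1$ passes over all the other $b-1$ strands to position $b$, while each other strand moves up by one position without the other strands crossing each other. (Thus, in a $\mathbb{Z}$-coloring, one elementary braid changes the colors $(c_1,\dots,c_b)$ of its left ends to $(2c_1-c_2,\dots,2c_1-c_b,c_1)$ at its right ends.) For $a\leq -1$, $B(a,b)$ is the diagram of the inverse braid, i.e. the reflection of $B(|a|,b)$ in a vertical line. The standard diagram of $T(a,b)$ is the closure of $B(a,b)$. An assignment of colors to the $b$ left ends of $B(a,b)$ determines a unique $\mathbb{Z}$-coloring of $B(a,b)$; it defines a $\mathbb{Z}$-coloring of the closure if and only if the resulting colors of the right ends coincide with those of the left ends. The $qr$ arcs at the left end of $B(pr,qr)$ are divided, from top to bottom, into $q$ families $\boldsymbol{x}_1,\dots,\boldsymbol{x}_q$ of $r$ consecutive arcs each: $\boldsymbol{x}_i=(x_{i,1},\dots,x_{i,r})$, where $x_{i,j}$ is the arc in position $(i-1)r+j$. Assigning $\boldsymbol{a}_i=(a_{i,1},\dots,a_{i,r})$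 to $\boldsymbol{x}_i$ means giving $x_{i,j}$ the color $a_{i,j}$. *)

theory Defs
  imports Main "HOL-Library.FuncSet"
begin

section \<open>Link diagrams and their \<open>\<int>\<close>-colorings\<close>

text \<open>Only the part of a link diagram that matters for colorings is kept: its arcs and, for each
  crossing, the triple consisting of the over arc and the two under arcs.\<close>

record 'a diagram =
  arcs :: "'a set"
  crossings :: "('a \<times> 'a \<times> 'a) list"

definition Z_colorings :: "'a diagram \<Rightarrow> ('a \<Rightarrow> int) set" where
  "Z_colorings D = {\<gamma> \<in> arcs D \<rightarrow>\<^sub>E UNIV. \<forall>(a, b, c) \<in> set (crossings D). 2 * \<gamma> a = \<gamma> b + \<gamma> c}"


section \<open>Braid diagrams\<close>

text \<open>A braid diagram on horizontal strands, in positions \<open>1, 2, \<dots>\<close> from top to bottom, is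
  the list of its crossings from left to right. Read from left to right, the over strand goes from
  position \<open>i\<close> to \<open>i + 1\<close> in \<open>Down i\<close>, and from \<open>i + 1\<close> to \<open>i\<close> in \<open>Up i\<close>.\<close>

datatype braid_crossing = Down nat | Up nat

type_synonym braid = "braid_crossing list"

fun reflect_crossing :: "braid_crossing \<Rightarrow> braid_crossing" where
  "reflect_crossing (Down i) = Up i"
| "reflect_crossing (Up i) = Down i"

text \<open>Reflection in a vertical line; over strands remain over strands.\<close>

definition reflect :: "braid \<Rightarrow> braid" where
  "reflect w = rev (map reflect_crossing w)"

definition elementary_braid :: "nat \<Rightarrow> braid" where
  "elementary_braid b = map Down [1..<b]"

definition torus_braid :: "int \<Rightarrow> nat \<Rightarrow> braid" where
  "torus_braid a b =
     (if a \<ge> 0 then concat (replicate (nat a) (elementary_braid b))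
      else reflect (concat (replicate (nat \<bar>a\<bar>) (elementary_braid b))))"


section \<open>Closure of a braid diagram\<close>

text \<open>The segment \<open>(k, i)\<close> is the piece of strand in position \<open>i\<close> just after the first \<open>k\<close>
  crossings. In particular, \<open>(0, i)\<close> and \<open>(length w, i)\<close> are the left and right ends in
  position \<open>i\<close>.\<close>

type_synonym segment = "nat \<times> nat"

definition segments :: "nat \<Rightarrow> braid \<Rightarrow> segment set" where
  "segments b w = {0..length w} \<times> {1..b}"

text \<open>\<open>continues s i j\<close>: the segment entering \<open>s\<close> in position \<open>i\<close> leaves it, in position \<open>j\<close>,
  without having passed under another strand.\<close>

fun continues :: "braid_crossing \<Rightarrow> nat \<Rightarrow> nat \<Rightarrow> bool" where
  "continues (Down t) i j \<longleftrightarrow> i = t \<and> j = t + 1 \<or> i \<notin> {t, t + 1} \<and> j = i"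
| "continues (Up t) i j \<longleftrightarrow> i = t + 1 \<and> j = t \<or> i \<notin> {t, t + 1} \<and> j = i"

definition joins :: "nat \<Rightarrow> braid \<Rightarrow> segment rel" where
  "joins b w = {((k, i), (Suc k, j)) | k i j.
     k < length w \<and> i \<in> {1..b} \<and> j \<in> {1..b} \<and> continues (w ! k) i j}"

definition closing_joins :: "nat \<Rightarrow> braid \<Rightarrow> segment rel" where
  "closing_joins b w = {((length w, i), (0, i)) | i. i \<in> {1..b}}"

text \<open>The arcs of the closure are the classes of the equivalence relation generated by both kinds
  of joins.\<close>

definition same_arc :: "nat \<Rightarrow> braid \<Rightarrow> segment rel" where
  "same_arc b w = (let R = joins b w \<union> closing_joins b w in (R \<union> R\<inverse>)\<^sup>*)"

definition arc_of :: "nat \<Rightarrow> braid \<Rightarrow> segment \<Rightarrow> segment set" where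
  "arc_of b w s = same_arc b w `` {s}"

fun crossing_segments :: "nat \<Rightarrow> braid_crossing \<Rightarrow> segment \<times> segment \<times> segment" where
  "crossing_segments k (Down i) = ((k, i), (k, i + 1), (Suc k, i))"
| "crossing_segments k (Up i) = ((k, i + 1), (k, i), (Suc k, i + 1))"

definition closure_diagram :: "nat \<Rightarrow> braid \<Rightarrow> segment set diagram" where
  "closure_diagram b w =
     \<lparr>arcs = segments b w // same_arc b w,
      crossings = map (\<lambda>k. case crossing_segments k (w ! k) of
          (s, t, u) \<Rightarrow> (arc_of b w s, arc_of b w t, arc_of b w u)) [0..<length w]\<rparr>"

definition torus_link_diagram :: "int \<Rightarrow> nat \<Rightarrow> segment set diagram" where
  "torus_link_diagram a b = closure_diagram b (torus_braid a b)"


section \<open>Colorings of the torus link \<open>T(pr, qr)\<close>\<close>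

text \<open>Elements of \<open>\<int>\<^sup>r\<close> are lists of length \<open>r\<close>, indexed from 0.
  \<open>family_arc p q r i j\<close> is the arc \<open>x\<^sub>i\<^sub>,\<^sub>j\<close>, viewed in the closure; \<open>i\<close> and \<open>j\<close> start from 1.\<close>

definition family_arc :: "int \<Rightarrow> nat \<Rightarrow> nat \<Rightarrow> nat \<Rightarrow> nat \<Rightarrow> segment set" where
  "family_arc p q r i j =
     arc_of (q * r) (torus_braid (p * int r) (q * r)) (0, (i - 1) * r + j)"

definition coloring_vectors :: "int \<Rightarrow> nat \<Rightarrow> nat \<Rightarrow> int list list set" where
  "coloring_vectors p q r =
     {as. length as = q \<and> (\<forall>a \<in> set as. length a = r) \<and>
        (\<exists>\<gamma> \<in> Z_colorings (torus_link_diagram (p * int r) (q * r)).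
           \<forall>i \<in> {1..q}. \<forall>j \<in> {1..r}. \<gamma> (family_arc p q r i j) = as ! (i - 1) ! (j - 1))}"

definition Delta :: "int list \<Rightarrow> int" where
  "Delta a = (\<Sum>i<length a. (-1) ^ i * a ! i)"

definition tau :: "int list \<Rightarrow> int list" where
  "tau a = map (\<lambda>x. - x + 2 * Delta a) a"

end

theory Submission
  imports Defs
begin

text \<open>A coloring of the closure of a braid diagram is the same as a tuple of colors at the left ends
  that reappears at the right ends (\<open>closure_coloring_iff\<close>), so the fixed tuples of the torus braid
  have to be found.

  Let \<open>s\<^sub>x\<close> be the reflection \<open>y \<mapsto> 2 x - y\<close> of \<open>\<int>\<close>. Since \<open>s\<^sub>x\<close> fixes \<open>x\<close>, the elementary
  braid sends the colors \<open>(c\<^sub>0, \<dots>, c\<^sub>b\<^sub>-\<^sub>1)\<close> to \<open>s\<^sub>c\<^sub>0\<close> applied entrywise to the rotated tuple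
  \<open>(c\<^sub>1, \<dots>, c\<^sub>b\<^sub>-\<^sub>1, c\<^sub>0)\<close>. Extending \<open>c\<close> to a sequence \<open>e\<close> of period \<open>b\<close>, this reads
  \<open>e' i = 2 * e 0 - e (i + 1)\<close>, with no special treatment of the last position. Iterating \<open>k\<close> times
  multiplies \<open>k\<close> reflections and gives (\<open>twist_funpow\<close>)
  \<open>(-1) ^ k * e (i + k) + 2 * (e 0 - e 1 + \<dots> \<plusminus> e (k - 1))\<close>.
  A negative number of elementary braids undoes a positive number of them, hence has the same fixed
  tuples, so only \<open>m = \<bar>p\<bar>\<close> matters.

  Take \<open>b = q r\<close>, \<open>k = m r\<close>, and cut \<open>e\<close> into families \<open>F 0, F 1, \<dots>\<close> of \<open>r\<close> consecutive terms; \<open>F\<close>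
  has period \<open>q\<close>. Then \<open>e\<close> is fixed exactly if every entry of every family satisfies
  \<open>F i = (-1) ^ (m r) * F (i + m) + 2 * S\<close>, where \<open>S\<close> is the alternating sum of the first \<open>m r\<close> terms
  of \<open>e\<close> (\<open>coloring_vectors_iff\<close>).

  If \<open>m r\<close> is even, going \<open>q\<close> times around gives \<open>F i = F i + 2 q S\<close>, so \<open>S = 0\<close> and \<open>F\<close> has
  both periods \<open>m\<close> and \<open>q\<close>. These are coprime, so all families equal one \<open>a\<close>. What remains is
  \<open>S = 0\<close>, where \<open>S = m * Delta a\<close> for even \<open>r\<close>, while for odd \<open>r\<close> and even \<open>m\<close> the families
  contribute to \<open>S\<close> with alternating signs and cancel.

  If \<open>m r\<close> is odd and \<open>q\<close> is even, then \<open>F (i + m)\<close> arises from \<open>F i\<close> by the reflection \<open>s\<^sub>S\<close>.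
  An inverse of \<open>m\<close> modulo \<open>q\<close> is odd, hence \<open>F (i + 1)\<close> arises from \<open>F i\<close> by \<open>s\<^sub>S\<close> as well.
  Substituting this into the alternating sum \<open>S\<close> gives \<open>m * (Delta (F 0) - S) = 0\<close>, so that
  \<open>s\<^sub>S\<close> is \<open>tau\<close> on the family \<open>F 0\<close>.\<close>


section \<open>Propagating colors through a braid diagram\<close>

fun pass :: "braid_crossing \<Rightarrow> (nat \<Rightarrow> int) \<Rightarrow> nat \<Rightarrow> int" where
  "pass (Down t) c = c(t := 2 * c t - c (t + 1), t + 1 := c t)"
| "pass (Up t) c = c(t := c (t + 1), t + 1 := 2 * c (t + 1) - c t)"

abbreviation run :: "braid \<Rightarrow> (nat \<Rightarrow> int) \<Rightarrow> nat \<Rightarrow> int" where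
  "run w \<equiv> fold pass w"

definition on_strands :: "nat \<Rightarrow> braid \<Rightarrow> bool" where
  "on_strands b w \<longleftrightarrow> (\<forall>x \<in> set w. \<exists>t \<in> {1..<b}. x = Down t \<or> x = Up t)"

lemma run_outside:
  assumes "on_strands b w" "i \<notin> {1..b}"
  shows "run w c i = c i"
  using assms
proof (induction w arbitrary: c)
  case (Cons x w)
  then have "pass x c i = c i"
    by (auto simp: on_strands_def)
  with Cons show ?case
    by (simp add: on_strands_def)
qed simp

lemma pass_reflect_crossing [simp]:
  "pass (reflect_crossing x) (pass x c) = c"
  "pass x (pass (reflect_crossing x) c) = c"
  by (cases x; auto simp: fun_eq_iff)+

lemma run_reflect [simp]:
  "run (reflect w) (run w c) = c"
  "run w (run (reflect w) c) = c"
  by (induction w arbitrary: c) (auto simp: reflect_def)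

text \<open>For colorings, the sign of the number of elementary braids is therefore irrelevant.\<close>

lemma run_reflect_fixed_iff: "run (reflect w) c = c \<longleftrightarrow> run w c = c"
  by (metis run_reflect)

lemma on_strands_reflect: "on_strands b w \<Longrightarrow> on_strands b (reflect w)"
  by (fastforce simp: on_strands_def reflect_def)


section \<open>Colorings of the closure of a braid diagram\<close>

lemma arc_of_eq:
  assumes "(s, t) \<in> joins b w \<union> closing_joins b w"
  shows "arc_of b w s = arc_of b w t"
proof -
  let ?S = "(joins b w \<union> closing_joins b w) \<union> (joins b w \<union> closing_joins b w)\<inverse>"
  have "(s, t) \<in> ?S" "(t, s) \<in> ?S"
    using assms by auto
  then show ?thesis
    unfolding arc_of_def same_arc_def Let_def
    by (auto intro: converse_rtrancl_into_rtrancl)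
qed

lemma same_arc_invariant:
  assumes "\<And>s t. (s, t) \<in> joins b w \<union> closing_joins b w \<Longrightarrow> f s = f t"
    and "t \<in> arc_of b w s"
  shows "f t = f s"
proof -
  have "(s, t) \<in> ((joins b w \<union> closing_joins b w) \<union> (joins b w \<union> closing_joins b w)\<inverse>)\<^sup>*"
    using assms(2) by (simp add: arc_of_def same_arc_def Let_def)
  then show ?thesis
  proof induction
    case (step y z)
    then show ?case
      using assms(1) by (metis UnE converseD)
  qed simp
qed

lemma self_in_arc_of: "s \<in> arc_of b w s"
  by (simp add: arc_of_def same_arc_def Let_def)

text \<open>Along a coloring, the colors to the right of each crossing are forced by those to its left,
  so the colors of the left ends propagate to all segments. Conversely, the propagated colors are
  constant on arcs as soon as they agree at the two ends of each closing strand.\<close>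

lemma closure_coloring_iff:
  assumes w: "on_strands b w"
  shows "(\<exists>\<gamma> \<in> Z_colorings (closure_diagram b w). \<forall>i \<in> {1..b}. \<gamma> (arc_of b w (0, i)) = c i)
    \<longleftrightarrow> run w c = c"
proof -
  define st where "st k = run (take k w) c" for k
  have st_0: "st 0 = c" and st_len: "st (length w) = run w c"
    by (simp_all add: st_def)
  have st_Suc: "st (Suc k) = pass (w ! k) (st k)" if "k < length w" for k
    using that by (simp add: st_def take_Suc_conv_app_nth)
  have w_nth: "\<exists>t \<in> {1..<b}. w ! k = Down t \<or> w ! k = Up t" if "k < length w" for k
    using w that by (auto simp: on_strands_def)
  show ?thesis
  proof
    assume "\<exists>\<gamma> \<in> Z_colorings (closure_diagram b w). \<forall>i \<in> {1..b}. \<gamma> (arc_of b w (0, i)) = c i"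
    then obtain \<gamma> where \<gamma>: "\<gamma> \<in> Z_colorings (closure_diagram b w)"
      and left: "\<And>i. i \<in> {1..b} \<Longrightarrow> \<gamma> (arc_of b w (0, i)) = c i"
      by blast
    define f where "f s = \<gamma> (arc_of b w s)" for s
    have f_join: "f (k, i) = f (Suc k, j)"
      if "k < length w" "i \<in> {1..b}" "j \<in> {1..b}" "continues (w ! k) i j" for k i j
      unfolding f_def by (rule arg_cong[OF arc_of_eq]) (use that in \<open>auto simp: joins_def\<close>)
    have f_close: "f (length w, i) = f (0, i)" if "i \<in> {1..b}" for i
      unfolding f_def by (rule arg_cong[OF arc_of_eq]) (use that in \<open>auto simp: closing_joins_def\<close>)
    have f_crossing: "case crossing_segments k (w ! k) of (s, t, u) \<Rightarrow> 2 * f s = f t + f u"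
      if "k < length w" for k
      using \<gamma> that by (fastforce simp: Z_colorings_def closure_diagram_def f_def split: prod.splits)
    have st_f: "k \<le> length w \<Longrightarrow> \<forall>i \<in> {1..b}. st k i = f (k, i)" for k
    proof (induction k)
      case 0
      then show ?case
        using left by (simp add: st_0 f_def)
    next
      case (Suc k)
      then have k: "k < length w" and IH: "\<And>i. i \<in> {1..b} \<Longrightarrow> st k i = f (k, i)"
        by auto
      obtain t where t: "t \<in> {1..<b}" and wk: "w ! k = Down t \<or> w ! k = Up t"
        using w_nth[OF k] by blast
      have other: "f (Suc k, i) = f (k, i)" if "i \<in> {1..b}" "i \<notin> {t, t + 1}" for i
        using f_join[OF k, of i i] that wk by auto
      have over: "w ! k = Down t \<Longrightarrow> f (Suc k, t + 1) = f (k, t)"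
          "w ! k = Up t \<Longrightarrow> f (Suc k, t) = f (k, t + 1)"
        using f_join[OF k, of t "t + 1"] f_join[OF k, of "t + 1" t] t by auto
      have under: "w ! k = Down t \<Longrightarrow> f (Suc k, t) = 2 * f (k, t) - f (k, t + 1)"
          "w ! k = Up t \<Longrightarrow> f (Suc k, t + 1) = 2 * f (k, t + 1) - f (k, t)"
        using f_crossing[OF k] by auto
      have at_t: "st k t = f (k, t)" "st k (t + 1) = f (k, t + 1)"
        using IH t by auto
      show ?case
        using wk
      proof
        assume D: "w ! k = Down t"
        show ?thesis
        proof
          fix i assume i: "i \<in> {1..b}"
          consider "i = t" | "i = t + 1" | "i \<notin> {t, t + 1}" by blast
          then show "st (Suc k) i = f (Suc k, i)"
            using st_Suc[OF k] D over(1)[OF D] under(1)[OF D] at_t other[OF i] IH[OF i]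
            by cases auto
        qed
      next
        assume U: "w ! k = Up t"
        show ?thesis
        proof
          fix i assume i: "i \<in> {1..b}"
          consider "i = t" | "i = t + 1" | "i \<notin> {t, t + 1}" by blast
          then show "st (Suc k) i = f (Suc k, i)"
            using st_Suc[OF k] U over(2)[OF U] under(2)[OF U] at_t other[OF i] IH[OF i]
            by cases auto
        qed
      qed
    qed
    show "run w c = c"
    proof
      fix i
      show "run w c i = c i"
      proof (cases "i \<in> {1..b}")
        case True
        then show ?thesis
          using st_f[of "length w"] st_f[of 0] f_close[OF True] by (simp add: st_0 st_len)
      next
        case False
        then show ?thesis
          by (rule run_outside[OF w])
      qed
    qed
  next
    assume fixed: "run w c = c"
    define f where "f s = st (fst s) (snd s)" for s :: segment
    have f_join: "f s = f t" if "(s, t) \<in> joins b w \<union> closing_joins b w" for s t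
    proof -
      from that consider (join) k i j where "s = (k, i)" "t = (Suc k, j)" "k < length w"
          "continues (w ! k) i j"
        | (close) i where "s = (length w, i)" "t = (0, i)"
        by (auto simp: joins_def closing_joins_def)
      then show ?thesis
      proof cases
        case join
        then show ?thesis
          by (cases "w ! k") (auto simp: f_def st_Suc)
      next
        case close
        then show ?thesis
          using fixed by (simp add: f_def st_0 st_len)
      qed
    qed
    define \<gamma> where "\<gamma> = (\<lambda>A \<in> arcs (closure_diagram b w). f (SOME s. s \<in> A))"
    have \<gamma>_arc: "\<gamma> (arc_of b w s) = f s" if "s \<in> segments b w" for s
    proof -
      have "arc_of b w s \<in> arcs (closure_diagram b w)"
        using that by (auto simp: closure_diagram_def arc_of_def quotient_def)
      moreover have "(SOME t. t \<in> arc_of b w s) \<in> arc_of b w s"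
        using self_in_arc_of by (rule someI)
      ultimately show ?thesis
        using same_arc_invariant[of b w f, OF f_join] by (simp add: \<gamma>_def)
    qed
    have crossing: "2 * \<gamma> (arc_of b w s) = \<gamma> (arc_of b w t) + \<gamma> (arc_of b w u)"
      if k: "k < length w" and stu: "crossing_segments k (w ! k) = (s, t, u)" for k s t u
    proof -
      obtain x where x: "x \<in> {1..<b}" "w ! k = Down x \<or> w ! k = Up x"
        using w_nth[OF k] by blast
      then have "s \<in> segments b w" "t \<in> segments b w" "u \<in> segments b w"
        using k stu by (auto simp: segments_def)
      moreover have "2 * f s = f t + f u"
        using x(2) stu by (auto simp: f_def st_Suc[OF k])
      ultimately show ?thesis
        by (simp add: \<gamma>_arc)
    qed
    have "\<gamma> \<in> Z_colorings (closure_diagram b w)"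
      unfolding Z_colorings_def
    proof (intro CollectI conjI)
      show "\<gamma> \<in> arcs (closure_diagram b w) \<rightarrow>\<^sub>E UNIV"
        by (simp add: \<gamma>_def)
      show "\<forall>(x, y, z) \<in> set (crossings (closure_diagram b w)). 2 * \<gamma> x = \<gamma> y + \<gamma> z"
        using crossing by (auto simp: closure_diagram_def split: prod.splits)
    qed
    moreover have "\<gamma> (arc_of b w (0, i)) = c i" if "i \<in> {1..b}" for i
      using that \<gamma>_arc[of "(0, i)"] by (simp add: segments_def f_def st_0)
    ultimately show
      "\<exists>\<gamma> \<in> Z_colorings (closure_diagram b w). \<forall>i \<in> {1..b}. \<gamma> (arc_of b w (0, i)) = c i"
      by blast
  qed
qed


section \<open>The torus braid as a twisted shift of periodic sequences\<close>

lemma run_elementary_braid: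
  "b \<ge> 1 \<Longrightarrow> run (elementary_braid b) c =
    (\<lambda>i. if i \<in> {1..<b} then 2 * c 1 - c (i + 1) else if i = b then c 1 else c i)"
proof (induction b rule: nat_induct_at_least)
  case base
  then show ?case
    by (auto simp: elementary_braid_def)
next
  case (Suc b)
  then have "elementary_braid (Suc b) = elementary_braid b @ [Down b]"
    by (simp add: elementary_braid_def)
  with Suc show ?case
    by (auto simp: fun_eq_iff)
qed

definition periodic_colors :: "nat \<Rightarrow> (nat \<Rightarrow> int) \<Rightarrow> nat \<Rightarrow> int" where
  "periodic_colors b c i = c (i mod b + 1)"

definition twist :: "(nat \<Rightarrow> int) \<Rightarrow> nat \<Rightarrow> int" where
  "twist e i = 2 * e 0 - e (i + 1)"

text \<open>At the last position, where the over strand arrives with color \<open>e 0\<close>, the formula of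
  \<open>twist\<close> gives \<open>2 * e 0 - e b = e 0\<close> by periodicity.\<close>

lemma periodic_colors_elementary_braid:
  assumes "b \<ge> 1"
  shows "periodic_colors b (run (elementary_braid b) c) = twist (periodic_colors b c)"
proof
  fix i
  show "periodic_colors b (run (elementary_braid b) c) i = twist (periodic_colors b c) i"
  proof (cases "Suc (i mod b) = b")
    case True
    then have "Suc i mod b = 0"
      by (simp add: mod_Suc)
    with True assms show ?thesis
      by (simp add: periodic_colors_def twist_def run_elementary_braid)
  next
    case False
    moreover have "i mod b < b"
      using assms by simp
    ultimately have "Suc (i mod b) < b"
      by linarith
    then show ?thesis
      using assms by (simp add: periodic_colors_def twist_def run_elementary_braid mod_Suc)
  qed
qed

lemma periodic_colors_torus_braid:
  assumes "b \<ge> 1"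
  shows "periodic_colors b (run (concat (replicate k (elementary_braid b))) c) =
    (twist ^^ k) (periodic_colors b c)"
  by (induction k arbitrary: c)
    (simp_all add: funpow_swap1 periodic_colors_elementary_braid[OF assms])

definition alt_sum :: "(nat \<Rightarrow> int) \<Rightarrow> nat \<Rightarrow> int" where
  "alt_sum e k = (\<Sum>j<k. (-1) ^ j * e j)"

lemma twist_funpow: "(twist ^^ k) e i = (-1) ^ k * e (i + k) + 2 * alt_sum e k"
  by (induction k arbitrary: i) (simp_all add: twist_def alt_sum_def algebra_simps)

lemma run_torus_braid_fixed_iff:
  assumes b: "b \<ge> 1"
  shows "run (torus_braid a b) c = c \<longleftrightarrow>
    (\<forall>i. periodic_colors b c i = (-1) ^ nat \<bar>a\<bar> * periodic_colors b c (i + nat \<bar>a\<bar>)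
      + 2 * alt_sum (periodic_colors b c) (nat \<bar>a\<bar>))"
proof -
  define w where "w = concat (replicate (nat \<bar>a\<bar>) (elementary_braid b))"
  have w: "on_strands b w"
    by (auto simp: w_def on_strands_def elementary_braid_def)
  have "run (torus_braid a b) c = c \<longleftrightarrow> run w c = c"
    by (auto simp: torus_braid_def w_def run_reflect_fixed_iff)
  also have "\<dots> \<longleftrightarrow> periodic_colors b (run w c) = periodic_colors b c"
  proof
    assume eq: "periodic_colors b (run w c) = periodic_colors b c"
    show "run w c = c"
    proof
      fix i
      show "run w c i = c i"
      proof (cases "i \<in> {1..b}")
        case True
        then have "(i - 1) mod b + 1 = i"
          by auto
        then show ?thesis
          using fun_cong[OF eq, of "i - 1"] by (simp only: periodic_colors_def)
      qed (rule run_outside[OF w])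
    qed
  qed simp
  also have "\<dots> \<longleftrightarrow> (\<forall>i. periodic_colors b c i = (twist ^^ nat \<bar>a\<bar>) (periodic_colors b c) i)"
    unfolding w_def periodic_colors_torus_braid[OF b] by (auto simp: fun_eq_iff)
  finally show ?thesis
    by (simp add: twist_funpow)
qed

lemma on_strands_torus_braid: "on_strands b (torus_braid a b)"
proof -
  have "on_strands b (concat (replicate k (elementary_braid b)))" for k
    by (auto simp: on_strands_def elementary_braid_def)
  then show ?thesis
    by (simp add: torus_braid_def on_strands_reflect)
qed


section \<open>Cutting the colors into families\<close>

text \<open>Families are indexed from 0 and repeated periodically, so that the shift by \<open>m\<close> families is an
  addition on all natural numbers.\<close>

definition family :: "int list list \<Rightarrow> nat \<Rightarrow> int list" where
  "family as i = as ! (i mod length as)"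

text \<open>This is the alternating sum of the first \<open>m * r\<close> colors; the sign \<open>(-1) ^ (i * r)\<close> is the one
  at which family \<open>i\<close> begins.\<close>

definition family_sum :: "nat \<Rightarrow> nat \<Rightarrow> int list list \<Rightarrow> int" where
  "family_sum m r as = (\<Sum>i<m. (-1) ^ (i * r) * Delta (family as i))"

lemma alt_sum_blocks:
  assumes "\<And>i. length (F i) = r"
    and "\<And>i j. j < r \<Longrightarrow> e (i * r + j) = F i ! j"
  shows "alt_sum e (m * r) = (\<Sum>i<m. (-1) ^ (i * r) * Delta (F i))"
proof -
  have "(\<Sum>x = i * r..<i * r + r. (-1) ^ x * e x) = (-1) ^ (i * r) * Delta (F i)" for i
    by (simp add: sum.atLeastLessThan_shift_0 atLeast0LessThan Delta_def assms sum_distrib_left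
        power_add mult.assoc)
  then show ?thesis
    by (simp add: alt_sum_def flip: sum.nat_group)
qed

text \<open>The shift of the colors by \<open>m * r\<close> positions moves whole families by \<open>m\<close> and keeps the
  position within a family, so the fixed-point equation splits into one affine relation between
  families.\<close>

lemma coloring_vectors_iff:
  fixes p :: int and q r :: nat
  assumes q: "q \<ge> 1" and r: "r \<ge> 1" and m: "m = nat \<bar>p\<bar>"
  shows "as \<in> coloring_vectors p q r \<longleftrightarrow>
    length as = q \<and> (\<forall>a \<in> set as. length a = r) \<and>
    (\<forall>i. family as i = map (\<lambda>x. (-1) ^ (m * r) * x + 2 * family_sum m r as) (family as (i + m)))"
proof (cases "length as = q \<and> (\<forall>a \<in> set as. length a = r)")
  case False
  then show ?thesis
    by (auto simp: coloring_vectors_def)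
next
  case True
  define b where "b = q * r"
  define c where "c x = as ! ((x - 1) div r) ! ((x - 1) mod r)" for x
  let ?w = "torus_braid (p * int r) b"
  let ?e = "periodic_colors b c"
  have b: "b \<ge> 1"
    using q r by (simp add: b_def)
  have len: "length (family as i) = r" for i
    using True q by (simp add: family_def)
  have e: "?e (i * r + j) = family as i ! j" if "j < r" for i j
  proof -
    have "(i * r + j) mod (r * q) = r * (i mod q) + j"
      using that r by (simp add: mod_mult2_eq)
    then show ?thesis
      using that r True by (simp add: periodic_colors_def c_def family_def b_def mult.commute)
  qed
  have k: "nat \<bar>p * int r\<bar> = m * r"
    by (simp add: m abs_mult nat_mult_distrib)
  have S: "alt_sum ?e (m * r) = family_sum m r as"
    unfolding family_sum_def by (rule alt_sum_blocks) (use len e in auto)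
  have ends: "(\<forall>i \<in> {1..q}. \<forall>j \<in> {1..r}. \<gamma> (family_arc p q r i j) = as ! (i - 1) ! (j - 1))
    \<longleftrightarrow> (\<forall>x \<in> {1..b}. \<gamma> (arc_of b ?w (0, x)) = c x)" (is "?L \<longleftrightarrow> ?R") for \<gamma>
  proof
    assume L: ?L
    show ?R
    proof
      fix x assume x: "x \<in> {1..b}"
      define i j where "i = (x - 1) div r + 1" and "j = (x - 1) mod r + 1"
      have "x - 1 < q * r"
        using x by (auto simp: b_def)
      then have i: "i \<in> {1..q}" and j: "j \<in> {1..r}"
        using r by (auto simp: i_def j_def less_mult_imp_div_less Suc_le_eq)
      have xij: "(i - 1) * r + j = x"
        using x by (simp add: i_def j_def)
      show "\<gamma> (arc_of b ?w (0, x)) = c x"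
        using L[rule_format, OF i j] unfolding family_arc_def xij b_def[symmetric]
        by (simp add: c_def i_def j_def)
    qed
  next
    assume R: ?R
    show ?L
    proof (intro ballI)
      fix i j assume i: "i \<in> {1..q}" and j: "j \<in> {1..r}"
      have "(i - 1) * r + j \<le> (i - 1) * r + r"
        using j by simp
      also have "\<dots> = i * r"
        using i by (cases i) auto
      also have "\<dots> \<le> b"
        using i by (simp add: b_def)
      finally have x: "(i - 1) * r + j \<in> {1..b}"
        using j by auto
      have "(i - 1) * r + j - 1 = (j - 1) + (i - 1) * r" and "j - 1 < r"
        using j by auto
      then have "c ((i - 1) * r + j) = as ! (i - 1) ! (j - 1)"
        unfolding c_def using r by simp
      then show "\<gamma> (family_arc p q r i j) = as ! (i - 1) ! (j - 1)"
        using R[rule_format, OF x] by (simp add: family_arc_def b_def)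
    qed
  qed
  have "as \<in> coloring_vectors p q r \<longleftrightarrow>
      (\<exists>\<gamma> \<in> Z_colorings (closure_diagram b ?w). \<forall>x \<in> {1..b}. \<gamma> (arc_of b ?w (0, x)) = c x)"
    using True
    unfolding coloring_vectors_def mem_Collect_eq ends torus_link_diagram_def b_def[symmetric]
    by blast
  also have "\<dots> \<longleftrightarrow> run ?w c = c"
    by (rule closure_coloring_iff[OF on_strands_torus_braid])
  also have "\<dots> \<longleftrightarrow> (\<forall>x. ?e x = (-1) ^ (m * r) * ?e (x + m * r) + 2 * family_sum m r as)"
    by (simp add: run_torus_braid_fixed_iff[OF b] k S)
  also have "\<dots> \<longleftrightarrow>
    (\<forall>i. family as i = map (\<lambda>x. (-1) ^ (m * r) * x + 2 * family_sum m r as) (family as (i + m)))"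
      (is "?L \<longleftrightarrow> ?R")
  proof
    assume L: ?L
    show ?R
    proof (intro allI nth_equalityI)
      fix i j assume "j < length (family as i)"
      then have j: "j < r"
        by (simp add: len)
      have "?e (i * r + j) = (-1) ^ (m * r) * ?e ((i + m) * r + j) + 2 * family_sum m r as"
        using L[rule_format, of "i * r + j"] by (simp add: algebra_simps)
      then show "family as i ! j =
          map (\<lambda>x. (-1) ^ (m * r) * x + 2 * family_sum m r as) (family as (i + m)) ! j"
        using j by (simp only: e nth_map len)
    qed (simp add: len)
  next
    assume R: ?R
    show ?L
    proof
      fix x
      define i j where "i = x div r" and "j = x mod r"
      have x: "x = i * r + j" and j: "j < r"
        using r by (simp_all add: i_def j_def)
      have xm: "x + m * r = (i + m) * r + j"
        by (simp add: x algebra_simps)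
      show "?e x = (-1) ^ (m * r) * ?e (x + m * r) + 2 * family_sum m r as"
        unfolding xm unfolding x e[OF j] using arg_cong[OF R[rule_format, of i], of "\<lambda>l. l ! j"] j
        by (simp add: len)
    qed
  qed
  finally show ?thesis
    using True by simp
qed

lemma family_add_length: "family as (i + length as * k) = family as i"
  by (simp add: family_def)

lemma funpow_shift:
  assumes "\<And>i. F i = \<phi> (F (i + m))"
  shows "F i = (\<phi> ^^ k) (F (i + m * k))"
proof (induction k arbitrary: i)
  case (Suc k)
  have "F i = \<phi> ((\<phi> ^^ k) (F (i + m + m * k)))"
    using assms[of i] Suc[of "i + m"] by simp
  then show ?case
    by (simp add: ac_simps)
qed simp

text \<open>By coprimality some multiple \<open>m * x\<close> is \<open>1\<close> modulo the period, so \<open>x\<close> steps of length \<open>m\<close>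
  amount to a single step.\<close>

lemma family_step:
  assumes "coprime m (length as)" "m \<noteq> 0" "\<And>i. family as i = \<phi> (family as (i + m))"
  obtains x y where "m * x = length as * y + 1"
    and "\<And>i. family as i = (\<phi> ^^ x) (family as (i + 1))"
proof -
  obtain x y where xy: "m * x = length as * y + gcd m (length as)"
    using bezout_nat[OF assms(2), of "length as"] by blast
  then have eq: "m * x = length as * y + 1"
    using assms(1) by simp
  have "family as i = (\<phi> ^^ x) (family as (i + 1))" for i
  proof -
    have "family as (i + m * x) = family as ((i + 1) + length as * y)"
      by (simp add: eq)
    also have "\<dots> = family as (i + 1)"
      by (rule family_add_length)
    finally show ?thesis
      using funpow_shift[of "family as" \<phi> m i x, OF assms(3)] by simp
  qed
  with eq show ?thesis
    by (rule that)
qed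


section \<open>The three cases\<close>

lemma family_replicate: "q \<ge> 1 \<Longrightarrow> family (replicate q a) i = a"
  by (simp add: family_def)

lemma family_map_upt:
  "q \<ge> 1 \<Longrightarrow> family (map f [0..<q]) i = f (i mod q)"
  by (simp add: family_def)

lemma family_nth: "i < length as \<Longrightarrow> as ! i = family as i"
  by (simp add: family_def)

lemma sum_minus_one_power: "(\<Sum>i<m. (-1::int) ^ i) = (if even m then 0 else 1)"
  by (induction m) auto

lemma minus_one_power_mult_odd: "odd r \<Longrightarrow> (-1::int) ^ (i * r) = (-1) ^ i"
  by (cases "even i") auto

lemma Delta_map_reflect:
  assumes "odd (length a)"
  shows "Delta (map (\<lambda>x. - x + 2 * s) a) = - Delta a + 2 * s"
proof -
  have "Delta (map (\<lambda>x. - x + 2 * s) a) =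
      (\<Sum>i<length a. - ((-1) ^ i * a ! i) + (-1) ^ i * (2 * s))"
    by (simp add: Delta_def algebra_simps)
  also have "\<dots> = - Delta a + (\<Sum>i<length a. (-1) ^ i) * (2 * s)"
    by (simp add: Delta_def sum_subtractf flip: sum_distrib_right)
  finally show ?thesis
    using assms by (simp add: sum_minus_one_power)
qed

text \<open>Families at distance \<open>m\<close> differ by the translation by \<open>2 * family_sum m r as\<close>. It has to be
  trivial, because \<open>q\<close> such shifts lead back to the same family.\<close>

lemma coloring_vectors_even:
  fixes p :: int and q r :: nat
  assumes q: "q \<ge> 1" and r: "r \<ge> 1" and m: "m = nat \<bar>p\<bar>" "m \<noteq> 0"
    and cop: "coprime m q" and ev: "even (m * r)"
  shows "coloring_vectors p q r =
    {replicate q a | a. length a = r \<and> family_sum m r (replicate q a) = 0}"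
proof (intro set_eqI iffI)
  have sgn: "(-1::int) ^ (m * r) = 1"
    using ev by simp
  fix as assume "as \<in> coloring_vectors p q r"
  then have len: "length as = q" and lens: "\<forall>a \<in> set as. length a = r"
    and rel: "\<And>i. family as i = map (\<lambda>x. x + 2 * family_sum m r as) (family as (i + m))"
    unfolding coloring_vectors_iff[OF q r m(1)] sgn mult_1_left by blast+
  let ?\<phi> = "map (\<lambda>x. x + 2 * family_sum m r as)"
  have pow: "(?\<phi> ^^ k) l = map (\<lambda>x. x + int k * (2 * family_sum m r as)) l" for k l
    by (induction k) (simp_all add: algebra_simps)
  have "family as 0 = (?\<phi> ^^ q) (family as (0 + m * q))"
    by (rule funpow_shift) (rule rel)
  also have "family as (0 + m * q) = family as 0"
    using family_add_length[of as 0 m] len by (simp add: mult.commute)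
  finally have "family as 0 ! 0 = family as 0 ! 0 + int q * (2 * family_sum m r as)"
    unfolding pow
    by (metis (no_types, lifting) One_nat_def Suc_le_eq family_def len lens mod_less_divisor
        nth_map nth_mem q r)
  then have S: "family_sum m r as = 0"
    using q by simp
  have "coprime m (length as)"
    using cop len by simp
  then obtain x y where "m * x = length as * y + 1"
    and step: "\<And>i. family as i = (?\<phi> ^^ x) (family as (i + 1))"
    by (rule family_step[OF _ m(2), of _ ?\<phi>]) (rule rel, rule that)
  have "family as (Suc i) = family as i" for i
    using step[of i] unfolding pow by (simp add: S)
  then have const: "family as i = family as 0" for i
    by (induction i) simp_all
  have "as ! i = family as 0" if "i < q" for i
    using family_nth[of i as] const[of i] that len by simp
  then have "as = replicate q (family as 0)"
    by (intro nth_equalityI[of as]) (simp_all add: len)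
  moreover have "length (family as 0) = r"
    using len lens q by (simp add: family_def)
  ultimately show "as \<in> {replicate q a | a. length a = r \<and> family_sum m r (replicate q a) = 0}"
    using S by auto
next
  fix as assume "as \<in> {replicate q a | a. length a = r \<and> family_sum m r (replicate q a) = 0}"
  then show "as \<in> coloring_vectors p q r"
    unfolding coloring_vectors_iff[OF q r m(1)] using q ev by (auto simp: family_replicate)
qed

text \<open>Here families at distance \<open>m\<close> are related by a reflection, which is an involution, and only the
  parity of the number of shifts matters. As \<open>q\<close> is even, the number of shifts that amounts to a
  single step modulo \<open>q\<close> is odd, so the same reflection relates neighbouring families. Its center
  is then determined by evaluating \<open>family_sum\<close> on the alternating families.\<close>

lemma coloring_vectors_odd:
  fixes p :: int and q r :: nat
  assumes q: "q \<ge> 1" and r: "odd r" and m: "m = nat \<bar>p\<bar>" and cop: "coprime m q"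
    and evq: "even q"
  shows "coloring_vectors p q r =
    {map (\<lambda>i. if even i then a else tau a) [0..<q] | a. length a = r}"
proof (intro set_eqI iffI)
  have oddm: "odd m"
    using cop evq by (metis coprime_common_divisor odd_one)
  have r1: "r \<ge> 1"
    using r by (cases r) auto
  have sgn: "(-1::int) ^ (m * r) = -1"
    using oddm r by simp
  {
    fix as assume "as \<in> coloring_vectors p q r"
    then have len: "length as = q" and lens: "\<forall>a \<in> set as. length a = r"
      and rel: "\<And>i. family as i = map (\<lambda>x. - x + 2 * family_sum m r as) (family as (i + m))"
      unfolding coloring_vectors_iff[OF q r1 m] sgn mult_minus1 by blast+
    define S where "S = family_sum m r as"
    define a where "a = family as 0"
    let ?\<phi> = "map (\<lambda>x. - x + 2 * S)"
    have len_a: "length a = r"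
      using len lens q by (simp add: family_def a_def)
    have invol: "?\<phi> (?\<phi> l) = l" for l
      by (simp add: comp_def)
    have odd_pow: "(?\<phi> ^^ x) l = ?\<phi> l" if "odd x" for x l
    proof -
      have "(?\<phi> ^^ (2 * k)) l = l" for k
        by (induction k) (simp_all add: comp_def)
      with that show ?thesis
        by (auto elim!: oddE)
    qed
    have "coprime m (length as)" "m \<noteq> 0"
      using cop len oddm by (auto simp: odd_pos)
    then obtain x y where xy: "m * x = length as * y + 1"
      and step: "\<And>i. family as i = (?\<phi> ^^ x) (family as (i + 1))"
      by (rule family_step[of _ _ ?\<phi>]) (rule rel[folded S_def], rule that)
    have "odd (m * x)"
      using xy len evq by simp
    then have "odd x"
      by simp
    then have step1: "family as i = ?\<phi> (family as (Suc i))" for i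
      using step[of i] odd_pow by simp
    have Suc: "family as (Suc i) = ?\<phi> (family as i)" for i
      by (subst step1[of i]) (simp only: invol)
    have alternate: "family as i = (if even i then a else ?\<phi> a)" for i
      by (induction i) (simp_all add: a_def Suc comp_def)
    have "S = (\<Sum>i<m. (-1) ^ i * Delta (family as i))"
      using r by (simp add: S_def family_sum_def minus_one_power_mult_odd)
    \<comment> \<open>The reflected families have \<open>Delta\<close> equal to \<open>2 * S - Delta a\<close>; adding and subtracting
      \<open>S\<close> makes the two parities look alike.\<close>
    also have "\<dots> = (\<Sum>i<m. (-1) ^ i * S + (Delta a - S))"
      using Delta_map_reflect[of a S] r by (intro sum.cong) (auto simp: alternate len_a)
    also have "\<dots> = S + int m * (Delta a - S)"
      using oddm by (simp add: sum.distrib sum_minus_one_power flip: sum_distrib_right)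
    finally have "S = Delta a"
      using oddm by (auto simp: odd_pos)
    then have phi_a: "?\<phi> a = tau a"
      by (simp add: tau_def)
    have "as ! i = (if even i then a else tau a)" if "i < q" for i
      using that len by (simp only: family_nth alternate phi_a)
    then have "as = map (\<lambda>i. if even i then a else tau a) [0..<q]"
      by (intro nth_equalityI[of as]) (simp_all add: len)
    then show "as \<in> {map (\<lambda>i. if even i then a else tau a) [0..<q] | a. length a = r}"
      using len_a by blast
  next
    fix as assume "as \<in> {map (\<lambda>i. if even i then a else tau a) [0..<q] | a. length a = r}"
    then obtain a where as: "as = map (\<lambda>i. if even i then a else tau a) [0..<q]"
      and a: "length a = r"
      by blast
    have fam: "family as i = (if even i then a else tau a)" for i
      unfolding as using q evq by (simp add: family_map_upt dvd_mod_iff)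
    have Delta_tau: "Delta (tau a) = Delta a"
      using Delta_map_reflect[of a "Delta a"] r a by (simp add: tau_def)
    have "family_sum m r as = (\<Sum>i<m. (-1) ^ i * Delta a)"
      using r Delta_tau
      by (auto simp: family_sum_def minus_one_power_mult_odd fam intro!: sum.cong)
    then have S: "family_sum m r as = Delta a"
      using oddm by (simp add: sum_minus_one_power flip: sum_distrib_right)
    have "map (\<lambda>x. - x + 2 * Delta a) a = tau a" "map (\<lambda>x. - x + 2 * Delta a) (tau a) = a"
      by (simp_all add: tau_def comp_def)
    then have "family as i = map (\<lambda>x. - x + 2 * family_sum m r as) (family as (i + m))" for i
      using oddm by (simp add: fam S)
    moreover have "length as = q \<and> (\<forall>a \<in> set as. length a = r)"
      using a by (auto simp: as tau_def)
    ultimately show "as \<in> coloring_vectors p q r"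
      unfolding coloring_vectors_iff[OF q r1 m] sgn mult_minus1 by blast
  }
qed

theorem proposition4p3:
  fixes p :: int and q r :: nat
  assumes "p \<noteq> 0" and "\<bar>p\<bar> \<ge> int q" and "q \<ge> 1" and "r \<ge> 2" and "coprime p (int q)"
  shows
    "(even r \<longrightarrow>
        coloring_vectors p q r = {replicate q a | a. length a = r \<and> Delta a = 0}) \<and>
     (odd r \<and> even p \<longrightarrow>
        coloring_vectors p q r = {replicate q a | a. length a = r}) \<and>
     (odd r \<and> even q \<longrightarrow>
        coloring_vectors p q r =
          {map (\<lambda>i. if even i then a else tau a) [0..<q] | a. length a = r})"
proof -
  define m where "m = nat \<bar>p\<bar>"
  have m0: "m \<noteq> 0"
    using assms(1) by (simp add: m_def)
  have int_m: "int m = \<bar>p\<bar>"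
    by (simp add: m_def)
  have cop: "coprime m q"
    using assms(5) by (simp flip: coprime_int_iff add: int_m)
  have even_m: "even m \<longleftrightarrow> even p"
    by (simp add: m_def even_nat_iff)
  have r1: "r \<ge> 1"
    using assms(4) by simp
  note even_case = coloring_vectors_even[OF assms(3) r1 m_def m0 cop]
  have sum_replicate: "family_sum m r (replicate q a) =
      (if even r then int m * Delta a else (\<Sum>i<m. (-1) ^ i) * Delta a)" for a
    using assms(3)
    by (auto simp: family_sum_def family_replicate minus_one_power_mult_odd sum_distrib_right)
  show ?thesis
  proof (intro conjI impI)
    assume "even r"
    then show "coloring_vectors p q r = {replicate q a | a. length a = r \<and> Delta a = 0}"
      using even_case m0 by (simp add: sum_replicate)
  next
    assume "odd r \<and> even p"
    then show "coloring_vectors p q r = {replicate q a | a. length a = r}"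
      using even_case even_m by (simp add: sum_replicate sum_minus_one_power)
  next
    assume "odd r \<and> even q"
    then show "coloring_vectors p q r =
        {map (\<lambda>i. if even i then a else tau a) [0..<q] | a. length a = r}"
      using coloring_vectors_odd[OF assms(3) _ m_def cop] by blast
  qed
qed

end
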